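(* Let $n$ be a positive integer. The total number of parts equal to $1$ in all partitions of $n$ (counted with multiplicity, summed over all partitions of $n$) is equal to $$\sum_{k=2}^{n+1} \phi(k)\, S^{(2)}_{n+1,k}.$$
   Context: A partition of a positive integer $m$ is a nonincreasing sequence of positive integers (its parts) summing to $m$. For integers $r\ge 1$, $k\ge 1$, $m\ge 1$, $S^{(r)}_{m,k}$ denotes the number of parts equal to $k$ (counted with multiplicity) summed over all partitions of $m$ whose smallest part is at least $r$. $\phi$ is Euler's totient function. *)

theory Defs
  imports "HOL-Number_Theory.Totient"
begin

definition partitions :: "nat \<Rightarrow> nat list set" where
  "partitions m = {p. sorted_wrt (\<ge>) p \<and> (\<forall>x\<in>set p. 0 < x) \<and> sum_list p = m}"

text \<open>
  For \<open>m \<ge> 1\<close> partitions are nonempty lists, so bounding every part from below by \<open>r\<close>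
  is the same as bounding the smallest part.
\<close>

definition S :: "nat \<Rightarrow> nat \<Rightarrow> nat \<Rightarrow> nat" where
  "S r m k = (\<Sum>p\<in>{p \<in> partitions m. \<forall>x\<in>set p. r \<le> x}. count_list p k)"

lemma finite_partitions: "finite (partitions m)"
proof (rule finite_subset)
  show "partitions m \<subseteq> {p. set p \<subseteq> {..m} \<and> length p \<le> m}"
  proof
    fix p assume "p \<in> partitions m"
    then have pos: "\<forall>x\<in>set p. 0 < x" and sum: "sum_list p = m"
      by (auto simp: partitions_def)
    from pos have "length p \<le> sum_list p"
      by (induction p) fastforce+
    then show "p \<in> {p. set p \<subseteq> {..m} \<and> length p \<le> m}"
      using sum member_le_sum_list by fastforce
  qed
  show "finite {p. set p \<subseteq> {..m} \<and> length p \<le> m}"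
    by (rule finite_lists_length_le) simp
qed

end

theory Submission
  imports Defs "HOL-Library.Multiset" "HOL-Library.FuncSet"
begin

text \<open>
  Let \<open>N r m\<close> be the number of partitions of \<open>m\<close> into parts \<open>\<ge> r\<close>. Removing \<open>j\<close> copies of \<open>k\<close>
  shows that \<open>S r m k\<close> is the sum of \<open>N r (m - d)\<close> over the positive multiples \<open>d \<le> m\<close> of \<open>k\<close>.
  Exchanging summation and using that \<open>totient\<close> sums to \<open>d\<close> over the divisors of \<open>d\<close>, the
  right-hand side becomes the sum of \<open>(d - 1) * N 2 (n + 1 - d)\<close> over \<open>1 \<le> d \<le> n + 1\<close>. As
  \<open>N 1 j\<close> is the sum of \<open>N 2 i\<close> over \<open>i \<le> j\<close>, this equals the sum of \<open>N 1 j\<close> over \<open>j < n\<close>,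
  which by the first step is \<open>S 1 n 1\<close>.
\<close>

text \<open>On multisets, inserting or removing copies of a part is addition or subtraction, with no
  order to restore. Positivity of the parts comes from taking \<open>r\<close> positive.\<close>

definition mset_partitions :: "nat \<Rightarrow> nat \<Rightarrow> nat multiset set" where
  "mset_partitions r m = {M. (\<forall>x\<in>#M. r \<le> x) \<and> sum_mset M = m}"

lemma bij_betw_mset_partitions:
  assumes "0 < r"
  shows "bij_betw mset {p \<in> partitions m. \<forall>x\<in>set p. r \<le> x} (mset_partitions r m)"
proof (rule bij_betwI[where g = "\<lambda>M. rev (sorted_list_of_multiset M)"])
  show "mset \<in> {p \<in> partitions m. \<forall>x\<in>set p. r \<le> x} \<rightarrow> mset_partitions r m"
    by (auto simp: partitions_def mset_partitions_def sum_mset_sum_list)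
  show "(\<lambda>M. rev (sorted_list_of_multiset M)) \<in>
      mset_partitions r m \<rightarrow> {p \<in> partitions m. \<forall>x\<in>set p. r \<le> x}"
  proof
    fix M assume M: "M \<in> mset_partitions r m"
    have "sorted_wrt (\<ge>) (rev (sorted_list_of_multiset M))"
      by (simp add: sorted_wrt_rev)
    moreover have "sum_list (rev (sorted_list_of_multiset M)) = m"
      using M by (simp add: mset_partitions_def flip: sum_mset_sum_list)
    ultimately show "rev (sorted_list_of_multiset M) \<in> {p \<in> partitions m. \<forall>x\<in>set p. r \<le> x}"
      using M assms by (force simp: partitions_def mset_partitions_def)
  qed
  show "rev (sorted_list_of_multiset (mset p)) = p"
    if "p \<in> {p \<in> partitions m. \<forall>x\<in>set p. r \<le> x}" for p
  proof -
    have "sorted (rev p)"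
      using that by (simp add: partitions_def sorted_wrt_rev)
    then have "sorted_list_of_multiset (mset (rev p)) = rev p"
      by (simp only: sorted_list_of_multiset_mset sorted_sort_id)
    then show ?thesis by simp
  qed
qed simp

lemma finite_mset_partitions: "0 < r \<Longrightarrow> finite (mset_partitions r m)"
  using bij_betw_finite[OF bij_betw_mset_partitions] finite_partitions by fastforce

lemma S_eq_sum_count:
  assumes "0 < r"
  shows "S r m k = (\<Sum>M\<in>mset_partitions r m. count M k)"
  unfolding S_def
  using sum.reindex_bij_betw[OF bij_betw_mset_partitions[OF assms], of "\<lambda>M. count M k" m]
  by (simp add: count_mset)

lemma count_mult_le_sum_mset: "count M k * k \<le> sum_mset (M :: nat multiset)"
proof -
  have "replicate_mset (count M k) k \<subseteq># M"
    by (simp add: count_le_replicate_mset_subset_eq[symmetric])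
  then obtain M' where "M = replicate_mset (count M k) k + M'"
    by (auto simp: subset_mset.le_iff_add)
  then show ?thesis
    by (metis le_add1 sum_mset.union sum_mset_replicate_mset of_nat_id)
qed

text \<open>Adding \<open>j\<close> copies of \<open>k\<close> is a bijection, inverted by removing
  them. The lower bound on the parts survives because \<open>r \<le> k\<close>, and
  \<open>j * k \<le> m\<close> keeps the subtraction from truncating.\<close>

lemma card_mset_partitions_count_ge:
  assumes "r \<le> k" "j * k \<le> m"
  shows "card {M \<in> mset_partitions r m. j \<le> count M k} = card (mset_partitions r (m - j * k))"
proof (rule sym, rule bij_betw_same_card[where f = "\<lambda>M. M + replicate_mset j k"],
    rule bij_betwI[where g = "\<lambda>M. M - replicate_mset j k"])
  show "(\<lambda>M. M + replicate_mset j k) \<in>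
      mset_partitions r (m - j * k) \<rightarrow> {M \<in> mset_partitions r m. j \<le> count M k}"
    using assms by (auto simp: mset_partitions_def split: if_splits)
  have sub: "replicate_mset j k \<subseteq># M" if "j \<le> count M k" for M
    using that by (simp add: count_le_replicate_mset_subset_eq)
  show "(\<lambda>M. M - replicate_mset j k) \<in>
      {M \<in> mset_partitions r m. j \<le> count M k} \<rightarrow> mset_partitions r (m - j * k)"
    using sub by (auto simp: mset_partitions_def sum_mset_diff dest: in_diffD)
  show "M - replicate_mset j k + replicate_mset j k = M"
    if "M \<in> {M \<in> mset_partitions r m. j \<le> count M k}" for M
    using that sub by simp
qed simp

text \<open>Double counting: \<open>count M k\<close> is the number of \<open>j \<ge> 1\<close> with
  \<open>j \<le> count M k\<close>. Encoding \<open>j\<close> as the multiple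
  \<open>d = j * k\<close> gives an index range independent of \<open>M\<close>, so the sums can be
  swapped.\<close>

lemma S_eq_sum_multiples:
  assumes "0 < r" "r \<le> k"
  shows "S r m k = (\<Sum>d | d \<in> {1..m} \<and> k dvd d. card (mset_partitions r (m - d)))"
proof -
  let ?D = "{d. d \<in> {1..m} \<and> k dvd d}" and ?R = "mset_partitions r m"
  have "0 < k" using assms by simp
  have count: "count M k = (\<Sum>d\<in>?D. if d div k \<le> count M k then 1 else 0)" if "M \<in> ?R" for M
  proof -
    have le: "count M k * k \<le> m"
      using that count_mult_le_sum_mset[of M k] by (simp add: mset_partitions_def)
    \<comment> \<open>By \<open>le\<close>, the cutoff \<open>d \<le> m\<close> loses none of the
      multiples \<open>j * k\<close> with \<open>j \<le> count M k\<close>.\<close>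
    have "{d \<in> ?D. d div k \<le> count M k} = (\<lambda>j. j * k) ` {1..count M k}"
    proof (intro equalityI subsetI)
      fix d assume "d \<in> {d \<in> ?D. d div k \<le> count M k}"
      then show "d \<in> (\<lambda>j. j * k) ` {1..count M k}"
        using \<open>0 < k\<close> by (intro image_eqI[where x = "d div k"]) (auto elim!: dvdE)
    next
      fix d assume "d \<in> (\<lambda>j. j * k) ` {1..count M k}"
      then obtain j where "d = j * k" "j \<in> {1..count M k}" by blast
      moreover from this have "j * k \<le> m"
        using le by (meson atLeastAtMost_iff le_trans mult_le_mono1)
      ultimately show "d \<in> {d \<in> ?D. d div k \<le> count M k}"
        using \<open>0 < k\<close> by auto
    qed
    then have "card {d \<in> ?D. d div k \<le> count M k} = count M k"
      using \<open>0 < k\<close> by (simp add: card_image inj_on_def)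
    then show ?thesis by (simp add: sum.If_cases Int_def conj_ac)
  qed
  have "S r m k = (\<Sum>M\<in>?R. \<Sum>d\<in>?D. if d div k \<le> count M k then 1 else 0)"
    unfolding S_eq_sum_count[OF \<open>0 < r\<close>] by (rule sum.cong[OF refl count])
  also have "\<dots> = (\<Sum>d\<in>?D. card {M \<in> ?R. d div k \<le> count M k})"
    using finite_mset_partitions[OF \<open>0 < r\<close>] by (subst sum.swap) (simp add: sum.If_cases Int_def)
  also have "\<dots> = (\<Sum>d\<in>?D. card (mset_partitions r (m - d)))"
  proof (rule sum.cong[OF refl])
    fix d assume "d \<in> ?D"
    then show "card {M \<in> ?R. d div k \<le> count M k} = card (mset_partitions r (m - d))"
      using card_mset_partitions_count_ge[OF assms(2), of "d div k" m] by simp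
  qed
  finally show ?thesis .
qed

text \<open>Induction on \<open>j\<close>: a partition of \<open>Suc j\<close> either has all parts
  at least 2, or contains a 1 whose removal leaves a partition of \<open>j\<close>.\<close>

lemma card_mset_partitions_eq_sum:
  "card (mset_partitions 1 j) = (\<Sum>i\<le>j. card (mset_partitions 2 i))"
proof (induction j)
  case 0
  have "mset_partitions 1 0 = {{#}}" "mset_partitions 2 0 = {{#}}"
    by (auto simp: mset_partitions_def)
       (metis multiset_nonemptyE not_numeral_le_zero not_one_le_zero One_nat_def)+
  then show ?case by simp
next
  case (Suc j)
  have "mset_partitions 1 (Suc j) =
      mset_partitions 2 (Suc j) \<union> {M \<in> mset_partitions 1 (Suc j). 1 \<le> count M 1}"
    by (auto simp: mset_partitions_def Suc_le_eq numeral_2_eq_2 count_greater_zero_iff)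
       (metis le_neq_implies_less Suc_leI)+
  moreover have "mset_partitions 2 (Suc j) \<inter> {M \<in> mset_partitions 1 (Suc j). 1 \<le> count M 1} = {}"
    by (auto simp: mset_partitions_def Suc_le_eq)
  ultimately have "card (mset_partitions 1 (Suc j)) = card (mset_partitions 2 (Suc j)) +
      card {M \<in> mset_partitions 1 (Suc j). 1 \<le> count M 1}"
    using finite_mset_partitions by (metis card_Un_disjoint finite_Un zero_less_one)
  then show ?case
    using Suc card_mset_partitions_count_ge[of 1 1 1 "Suc j"] by simp
qed

text \<open>Gauss's divisor sum with the divisor 1, which contributes \<open>totient 1 = 1\<close>,
  split off.\<close>

lemma sum_totient_divisors_ge_2:
  assumes "0 < d"
  shows "(\<Sum>k | k dvd d \<and> 2 \<le> k. totient k) = d - 1"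
proof -
  have "{k. k dvd d} = insert 1 {k. k dvd d \<and> 2 \<le> k}"
    using assms by (auto simp: numeral_2_eq_2 Suc_le_eq intro: Suc_lessI dest: dvd_pos_nat)
  moreover have "finite {k. k dvd d \<and> 2 \<le> k}"
    using assms by simp
  ultimately have "(\<Sum>k | k dvd d. totient k) = 1 + (\<Sum>k | k dvd d \<and> 2 \<le> k. totient k)"
    by simp
  then show ?thesis using totient_divisor_sum[of d] by simp
qed

text \<open>Each \<open>f i\<close> is counted once for every \<open>j\<close> with
  \<open>i \<le> j < n\<close>, hence \<open>n - i\<close> times; the term \<open>i = n\<close> is
  zero.\<close>

lemma sum_partial_sums:
  fixes f :: "nat \<Rightarrow> nat"
  shows "(\<Sum>j<n. \<Sum>i\<le>j. f i) = (\<Sum>i\<le>n. (n - i) * f i)"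
proof (induction n)
  case (Suc n)
  have "(\<Sum>i\<le>Suc n. (Suc n - i) * f i) = (\<Sum>i\<le>n. (n - i) * f i + f i)"
    by (simp add: Suc_diff_le add.commute)
  then show ?case using Suc by (simp add: sum.distrib)
qed simp

theorem theorem2:
  fixes n :: nat
  assumes "n \<ge> 1"
  shows "(\<Sum>p\<in>partitions n. count_list p 1) = (\<Sum>k=2..n+1. totient k * S 2 (n+1) k)"
proof -
  let ?N = "\<lambda>r m. card (mset_partitions r m)"
  have "(\<Sum>k=2..n+1. totient k * S 2 (n+1) k) =
      (\<Sum>k=2..n+1. \<Sum>d | d \<in> {1..n+1} \<and> k dvd d. totient k * ?N 2 (n + 1 - d))"
    by (intro sum.cong refl) (simp add: S_eq_sum_multiples sum_distrib_left)
  also have "\<dots> = (\<Sum>d=1..n+1. \<Sum>k | k \<in> {2..n+1} \<and> k dvd d. totient k * ?N 2 (n + 1 - d))"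
    by (rule sum.swap_restrict) auto
  also have "\<dots> = (\<Sum>d=1..n+1. (d - 1) * ?N 2 (n + 1 - d))"
  proof (rule sum.cong[OF refl])
    \<comment> \<open>A divisor of \<open>d\<close> is at most \<open>d\<close>, so the upper bound
      \<open>n + 1\<close> on \<open>k\<close> excludes none.\<close>
    fix d assume d: "d \<in> {1..n+1}"
    then have "{k. k \<in> {2..n+1} \<and> k dvd d} = {k. k dvd d \<and> 2 \<le> k}"
      by (auto dest: dvd_imp_le)
    then show "(\<Sum>k | k \<in> {2..n+1} \<and> k dvd d. totient k * ?N 2 (n + 1 - d)) =
        (d - 1) * ?N 2 (n + 1 - d)"
      using d sum_totient_divisors_ge_2[of d] by (simp flip: sum_distrib_right)
  qed
  \<comment> \<open>Substituting \<open>i = n + 1 - d\<close> turns the factor \<open>d - 1\<close>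
    into \<open>n - i\<close>.\<close>
  also have "\<dots> = (\<Sum>i\<le>n. (n - i) * ?N 2 i)"
    by (rule sum.reindex_bij_witness[where i = "\<lambda>i. n + 1 - i" and j = "\<lambda>d. n + 1 - d"]) auto
  also have "\<dots> = (\<Sum>j<n. ?N 1 j)"
    by (simp only: card_mset_partitions_eq_sum sum_partial_sums)
  also have "\<dots> = (\<Sum>d=1..n. ?N 1 (n - d))"
    by (rule sum.reindex_bij_witness[where i = "\<lambda>d. n - d" and j = "\<lambda>j. n - j"]) auto
  \<comment> \<open>Every \<open>d\<close> is a multiple of 1, so the sum over multiples runs over
    all of \<open>{1..n}\<close>.\<close>
  also have "\<dots> = S 1 n 1"
    by (simp add: S_eq_sum_multiples atLeastAtMost_def atLeast_def atMost_def Int_def)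
  also have "\<dots> = (\<Sum>p\<in>partitions n. count_list p 1)"
    unfolding S_def by (rule sum.cong) (auto simp: partitions_def Suc_le_eq)
  finally show ?thesis by simp
qed

end
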